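(* Let $\mathbb{A}$ be a unital $C^*$-algebra, let $(X,\mathbb{A},d)$ be a complete $C^*$-algebra valued metric space, let $\varphi: X\to\mathbb{A}_+$ be a function, let $F\in\mathcal{F}$, and let $T:X\to X$. Suppose that: (a) $\varphi$ is lower semi-continuous; (b) $T$ is an $(F,\varphi)$-weak contraction with respect to $d$, i.e. there are real numbers $k\in(0,1)$ and $\alpha\ge 0$ such that for all $x,y\in X$ $$F(d(Tx,Ty),\varphi(Tx),\varphi(Ty))\preceq k\,F(d(x,y),\varphi(x),\varphi(y))+\alpha\bigl(F(d(y,Tx),\varphi(y),\varphi(Tx))-F(\theta,\varphi(y),\varphi(Tx))\bigr).$$ Then: (i) $F_T\subseteq Z_\varphi$; (ii) $T$ is a weakly $\varphi$-Picard operator; (iii) for all $x\in X$, if $T^n x\to z$ as $n\to\infty$, then $$d(T^n x,z)\preceq \frac{k^n}{1-k}\,F(d(Tx,x),\varphi(x),\varphi(Tx))\quad\text{for all } n\in\mathbb{N}.$$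
   Context: $\mathbb{A}$ is a unital $C^*$-algebra with zero element $\theta$; $\mathbb{A}_+$ is the set of positive elements (self-adjoint with spectrum in $[0,\infty)$), and for self-adjoint $a,b$, $a\preceq b$ means $b-a\in\mathbb{A}_+$. A $C^*$-algebra valued metric space $(X,\mathbb{A},d)$ is a non-empty set $X$ with $d:X\times X\to\mathbb{A}$ such that for all $x,y,z$: $\theta\preceq d(x,y)$, with $d(x,y)=\theta$ iff $x=y$; $d(x,y)=d(y,x)$; $d(x,y)\preceq d(x,z)+d(z,y)$. Convergence $x_n\to x$ means $\|d(x_n,x)\|\to0$; $(x_n)$ is Cauchy if $\|d(x_n,x_m)\|\to 0$ as $n,m\to\infty$; the space is complete if every Cauchy sequence converges. $\mathcal{F}$ is the set of functions $F:\mathbb{A}_+^3\to\mathbb{A}_+$ such that (F1) $\max\{x,y\}\preceq F(x,y,z)$ for all $x,y,z\in\mathbb{A}_+$, meaning $x\preceq F(x,y,z)$ and $y\preceq F(x,y,z)$; (F2) $F(\theta,\theta,\theta)=\theta$; (F3) $F$ is (norm) continuous. $\varphi:X\to\mathbb{A}_+$ is lower semi-continuous if $x_n\to x$ in $X$ implies $\|\varphi(x)\|\le\liminf_n\|\varphi(x_n)\|$. $T^0$ is the identity of $X$ and $T^{n+1}=T\circ T^n$. $F_T=\{x\in X: Tx=x\}$ and $Z_\varphi=\{x\in X:\varphi(x)=\theta\}$. A $\varphi$-fixed point of $T$ is an element of $F_T\cap Z_\varphi$. $T$ is a weakly $\varphi$-Picard operator if $F_T\cap Z_\varphi\neq\emptyset$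 and, for every $x\in X$, the sequence $(T^n x)$ converges and its limit is a $\varphi$-fixed point of $T$. *)

theory Defs
  imports "HOL-Analysis.Analysis"
begin

(* The scaleR of the real Banach algebra is required to be the restriction of the complex
   scalar multiplication scaleC.  The unit comes from monoid_mult rather than from
   real_normed_algebra_1, so that the zero algebra is not excluded. *)
class unital_cstar_algebra = real_normed_algebra + banach + monoid_mult +
  fixes scaleC :: "complex \<Rightarrow> 'a \<Rightarrow> 'a"  (infixr "*\<^sub>C" 75)
    and star :: "'a \<Rightarrow> 'a"
  assumes scaleR_scaleC: "r *\<^sub>R a = complex_of_real r *\<^sub>C a"
    and scaleC_add_right: "c *\<^sub>C (a + b) = c *\<^sub>C a + c *\<^sub>C b"
    and scaleC_add_left: "(c + c') *\<^sub>C a = c *\<^sub>C a + c' *\<^sub>C a"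
    and scaleC_scaleC: "c *\<^sub>C c' *\<^sub>C a = (c * c') *\<^sub>C a"
    and mult_scaleC_left: "(c *\<^sub>C a) * b = c *\<^sub>C (a * b)"
    and mult_scaleC_right: "a * (c *\<^sub>C b) = c *\<^sub>C (a * b)"
    and norm_scaleC: "norm (c *\<^sub>C a) = cmod c * norm a"
    and star_star: "star (star a) = a"
    and star_add: "star (a + b) = star a + star b"
    and star_scaleC: "star (c *\<^sub>C a) = cnj c *\<^sub>C star a"
    and star_mult: "star (a * b) = star b * star a"
    and cstar_identity: "norm (star a * a) = (norm a)\<^sup>2"

definition spectrum :: "'a::unital_cstar_algebra \<Rightarrow> complex set" where
  "spectrum a =
    {c. \<not> (\<exists>b. b * (a - c *\<^sub>C 1) = 1 \<and> (a - c *\<^sub>C 1) * b = 1)}"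

definition pos_elems :: "'a::unital_cstar_algebra set" where
  "pos_elems = {a. star a = a \<and> spectrum a \<subseteq> complex_of_real ` {0..}}"

(* This is the order of the self-adjoint part; it is only used between self-adjoint elements. *)
definition cstar_le :: "'a::unital_cstar_algebra \<Rightarrow> 'a \<Rightarrow> bool"  (infix "\<preceq>" 50) where
  "a \<preceq> b \<longleftrightarrow> b - a \<in> pos_elems"

locale cstar_metric_space =
  fixes X :: "'x set" and d :: "'x \<Rightarrow> 'x \<Rightarrow> 'a::unital_cstar_algebra"
  assumes nonempty: "X \<noteq> {}"
    and nonneg: "\<lbrakk>x \<in> X; y \<in> X\<rbrakk> \<Longrightarrow> 0 \<preceq> d x y"
    and zero_iff: "\<lbrakk>x \<in> X; y \<in> X\<rbrakk> \<Longrightarrow> d x y = 0 \<longleftrightarrow> x = y"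
    and commute: "\<lbrakk>x \<in> X; y \<in> X\<rbrakk> \<Longrightarrow> d x y = d y x"
    and triangle: "\<lbrakk>x \<in> X; y \<in> X; z \<in> X\<rbrakk> \<Longrightarrow> d x y \<preceq> d x z + d z y"

definition converges_to ::
  "'x set \<Rightarrow> ('x \<Rightarrow> 'x \<Rightarrow> 'a::unital_cstar_algebra) \<Rightarrow> (nat \<Rightarrow> 'x) \<Rightarrow> 'x \<Rightarrow> bool" where
  "converges_to X d s x \<longleftrightarrow>
    range s \<subseteq> X \<and> x \<in> X \<and> (\<lambda>n. norm (d (s n) x)) \<longlonglongrightarrow> 0"

definition Cauchy_seq ::
  "'x set \<Rightarrow> ('x \<Rightarrow> 'x \<Rightarrow> 'a::unital_cstar_algebra) \<Rightarrow> (nat \<Rightarrow> 'x) \<Rightarrow> bool" where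
  "Cauchy_seq X d s \<longleftrightarrow>
    range s \<subseteq> X \<and> (\<forall>e>0. \<exists>N. \<forall>n\<ge>N. \<forall>m\<ge>N. norm (d (s n) (s m)) < e)"

locale complete_cstar_metric_space = cstar_metric_space +
  assumes complete: "Cauchy_seq X d s \<Longrightarrow> \<exists>x. converges_to X d s x"

(* The class of control functions F.  Such an F maps triples of positive elements to positive
   elements; its values elsewhere are irrelevant. *)
definition control_funs :: "('a::unital_cstar_algebra \<Rightarrow> 'a \<Rightarrow> 'a \<Rightarrow> 'a) set" where
  "control_funs = {F.
     (\<forall>x\<in>pos_elems. \<forall>y\<in>pos_elems. \<forall>z\<in>pos_elems. F x y z \<in> pos_elems) \<and>
     (\<forall>x\<in>pos_elems. \<forall>y\<in>pos_elems. \<forall>z\<in>pos_elems. x \<preceq> F x y z \<and> y \<preceq> F x y z) \<and>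
     F 0 0 0 = 0 \<and>
     continuous_on (pos_elems \<times> pos_elems \<times> pos_elems) (\<lambda>(x, y, z). F x y z)}"

definition lower_semicontinuous ::
  "'x set \<Rightarrow> ('x \<Rightarrow> 'x \<Rightarrow> 'a::unital_cstar_algebra) \<Rightarrow> ('x \<Rightarrow> 'a) \<Rightarrow> bool" where
  "lower_semicontinuous X d \<phi> \<longleftrightarrow>
    (\<forall>s x. converges_to X d s x \<longrightarrow>
       ereal (norm (\<phi> x)) \<le> liminf (\<lambda>n. ereal (norm (\<phi> (s n)))))"

definition weak_contraction ::
  "'x set \<Rightarrow> ('x \<Rightarrow> 'x \<Rightarrow> 'a::unital_cstar_algebra) \<Rightarrow> ('a \<Rightarrow> 'a \<Rightarrow> 'a \<Rightarrow> 'a) \<Rightarrow>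
    ('x \<Rightarrow> 'a) \<Rightarrow> real \<Rightarrow> real \<Rightarrow> ('x \<Rightarrow> 'x) \<Rightarrow> bool" where
  "weak_contraction X d F \<phi> k \<alpha> T \<longleftrightarrow>
    0 < k \<and> k < 1 \<and> 0 \<le> \<alpha> \<and>
    (\<forall>x\<in>X. \<forall>y\<in>X.
       F (d (T x) (T y)) (\<phi> (T x)) (\<phi> (T y)) \<preceq>
         k *\<^sub>R F (d x y) (\<phi> x) (\<phi> y) +
         \<alpha> *\<^sub>R (F (d y (T x)) (\<phi> y) (\<phi> (T x)) - F 0 (\<phi> y) (\<phi> (T x))))"

definition fixed_points :: "'x set \<Rightarrow> ('x \<Rightarrow> 'x) \<Rightarrow> 'x set" where
  "fixed_points X T = {x \<in> X. T x = x}"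

definition zero_set :: "'x set \<Rightarrow> ('x \<Rightarrow> 'a::zero) \<Rightarrow> 'x set" where
  "zero_set X \<phi> = {x \<in> X. \<phi> x = 0}"

definition weakly_Picard ::
  "'x set \<Rightarrow> ('x \<Rightarrow> 'x \<Rightarrow> 'a::unital_cstar_algebra) \<Rightarrow> ('x \<Rightarrow> 'a) \<Rightarrow> ('x \<Rightarrow> 'x) \<Rightarrow> bool" where
  "weakly_Picard X d \<phi> T \<longleftrightarrow>
    fixed_points X T \<inter> zero_set X \<phi> \<noteq> {} \<and>
    (\<forall>x\<in>X. \<exists>z. converges_to X d (\<lambda>n. (T ^^ n) x) z \<and>
       z \<in> fixed_points X T \<inter> zero_set X \<phi>)"

end

theory Submission
  imports Defs
begin

text \<open>
  Put \<open>y = T x\<close> in the contraction condition.  The first argument of the first term multiplied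
  by \<open>\<alpha>\<close> becomes \<open>d (T x) (T x) = 0\<close>, so that this term cancels against the second, and what
  remains says that \<open>F (d x (T x)) (\<phi> x) (\<phi> (T x))\<close> shrinks at least by the factor \<open>k\<close> whenever
  \<open>x\<close> is replaced by \<open>T x\<close>.  As \<open>F\<close> dominates its first two arguments, the step lengths
  \<open>d (T\<^sup>n x) (T\<^sup>n\<^sup>+\<^sup>1 x)\<close> and the values \<open>\<phi> (T\<^sup>n x)\<close> decay geometrically in the order of the algebra.
  Summing the steps makes the orbit Cauchy (\<open>iterates_dist_le\<close>), and the a priori estimate is
  the limit of these sums.  At the limit \<open>z\<close>, lower semicontinuity gives \<open>\<phi> z = 0\<close>.  The
  contraction condition for the pair \<open>T\<^sup>n x\<close>, \<open>z\<close> then bounds \<open>d (T\<^sup>n\<^sup>+\<^sup>1 x) (T z)\<close> by expressions in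
  \<open>F\<close> all of whose arguments tend to \<open>0\<close>; continuity and \<open>F 0 0 0 = 0\<close> give \<open>T z = z\<close>
  (\<open>limit_is_zero_and_fixed\<close>).

  All this rests on three facts about the order of a \<open>C\<^sup>*\<close>-algebra: the positive elements form a
  convex cone (\<open>pos_elems_add\<close>, \<open>pos_elems_scaleR\<close>), the cone is closed (\<open>pos_elems_limit\<close>), and
  the norm is monotone on it (\<open>norm_mono_cstar_le\<close>).  They follow once positivity, a condition on
  the spectrum, is turned into a norm inequality: a self-adjoint \<open>a\<close> with \<open>norm a \<le> t\<close> is
  positive iff \<open>norm (t - a) \<le> t\<close> (\<open>pos_elems_iff_norm_le\<close>).  This in turn needs that a
  self-adjoint element has real spectrum and that its norm is attained there
  (\<open>norm_attained_on_spectrum\<close>).  The latter is usually read off the spectral radius formula, whose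
  standard proof uses vector-valued holomorphic functions.  Here an elementary argument with
  averages of resolvents takes their place, which uses only the powers \<open>a ^ 2 ^ m\<close>: for
  self-adjoint \<open>a\<close> the norms of these are known exactly.
\<close>

section \<open>Scalars and involution\<close>

lemma scaleC_one [simp]: "1 *\<^sub>C a = (a::'a::unital_cstar_algebra)"
  using scaleR_scaleC[of 1 a] by simp

lemma scaleC_zero_left [simp]: "0 *\<^sub>C a = (0::'a::unital_cstar_algebra)"
  using scaleR_scaleC[of 0 a] by simp

lemma scaleC_minus_left: "(- c) *\<^sub>C a = - (c *\<^sub>C (a::'a::unital_cstar_algebra))"
  using scaleC_add_left[of "- c" c a] by (simp add: eq_neg_iff_add_eq_0)

lemma scaleC_diff_left: "(c - c') *\<^sub>C a = c *\<^sub>C a - c' *\<^sub>C (a::'a::unital_cstar_algebra)"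
  using scaleC_add_left[of c "- c'" a] by (simp add: scaleC_minus_left)

lemma scaleC_zero_right [simp]: "c *\<^sub>C (0::'a::unital_cstar_algebra) = 0"
  using scaleC_add_right[of c 0 0] by simp

lemma scaleC_minus_right: "c *\<^sub>C (- a) = - (c *\<^sub>C (a::'a::unital_cstar_algebra))"
  using scaleC_add_right[of c "- a" a] by (simp add: eq_neg_iff_add_eq_0)

lemma scaleC_diff_right: "c *\<^sub>C (a - b) = c *\<^sub>C a - c *\<^sub>C (b::'a::unital_cstar_algebra)"
  using scaleC_add_right[of c a "- b"] by (simp add: scaleC_minus_right)

lemma star_zero [simp]: "star (0::'a::unital_cstar_algebra) = 0"
  using star_add[of "0::'a" 0] by simp

lemma star_minus: "star (- a) = - star (a::'a::unital_cstar_algebra)"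
  using star_add[of "- a" a] by (simp add: eq_neg_iff_add_eq_0)

lemma star_diff: "star (a - b) = star a - star (b::'a::unital_cstar_algebra)"
  using star_add[of a "- b"] by (simp add: star_minus)

lemma star_scaleR: "star (r *\<^sub>R a) = r *\<^sub>R star (a::'a::unital_cstar_algebra)"
  by (simp add: scaleR_scaleC star_scaleC)

lemma star_one [simp]: "star (1::'a::unital_cstar_algebra) = 1"
  using star_mult[of "star (1::'a)" 1] by (simp add: star_star)

lemma norm_selfadjoint_square:
  "star a = a \<Longrightarrow> norm (a * a) = (norm (a::'a::unital_cstar_algebra))\<^sup>2"
  using cstar_identity[of a] by simp

text \<open>The \<open>C\<^sup>*\<close>-identity makes \<open>norm 1\<close> idempotent; the value \<open>0\<close> occurs in the zero algebra.\<close>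

lemma norm_one_le_one: "norm (1::'a::unital_cstar_algebra) \<le> 1"
proof -
  have "norm (1::'a) = norm (1::'a) * norm (1::'a)"
    using cstar_identity[of "1::'a"] by (simp add: power2_eq_square)
  then show ?thesis by (metis mult_cancel_right1 order_refl norm_zero zero_le_one)
qed

lemma norm_star [simp]: "norm (star a) = norm (a::'a::unital_cstar_algebra)"
proof -
  have *: "norm b \<le> norm (star b)" for b :: 'a
  proof (cases "b = 0")
    case False
    have "norm b * norm b \<le> norm (star b) * norm b"
      using norm_mult_ineq[of "star b" b] cstar_identity[of b] by (simp add: power2_eq_square)
    then show ?thesis using False by (simp add: mult_le_cancel_right)
  qed simp
  show ?thesis using *[of a] *[of "star a"] by (simp add: star_star)
qed

section \<open>Invertibility\<close>

definition two_sided_inverse :: "'a::monoid_mult \<Rightarrow> 'a \<Rightarrow> bool" where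
  "two_sided_inverse a b \<longleftrightarrow> b * a = 1 \<and> a * b = 1"

lemma two_sided_inverse_unique:
  "two_sided_inverse a b \<Longrightarrow> two_sided_inverse a c \<Longrightarrow> b = c"
  unfolding two_sided_inverse_def by (metis mult.assoc mult_1_left mult_1_right)

lemma two_sided_inverse_mult:
  assumes "two_sided_inverse a u" "two_sided_inverse b v"
  shows "two_sided_inverse (a * b) (v * u)"
  using assms unfolding two_sided_inverse_def
  by (metis mult.assoc mult_1_left)

lemma spectrum_iff: "c \<in> spectrum a \<longleftrightarrow> (\<nexists>b. two_sided_inverse (a - c *\<^sub>C 1) b)"
  by (simp add: spectrum_def two_sided_inverse_def)

lemma two_sided_inverse_scaleC:
  fixes a :: "'a::unital_cstar_algebra"
  assumes "c \<noteq> 0" "two_sided_inverse a u"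
  shows "two_sided_inverse (c *\<^sub>C a) (inverse c *\<^sub>C u)"
  using assms by (simp add: two_sided_inverse_def mult_scaleC_left mult_scaleC_right scaleC_scaleC)

text \<open>
  A left and a right inverse of \<open>1 - x\<close> are the fixed points of the contractions
  \<open>y \<mapsto> 1 + x * y\<close> and \<open>z \<mapsto> 1 + z * x\<close>.  This avoids summing the Neumann series.
\<close>

lemma neumann_inverse:
  fixes x :: "'a::unital_cstar_algebra"
  assumes "norm x < 1"
  shows "\<exists>y. two_sided_inverse (1 - x) y"
proof -
  have lip: "norm (x * y - x * y') \<le> norm x * norm (y - y')"
    "norm (y * x - y' * x) \<le> norm x * norm (y - y')" for y y'
    using norm_mult_ineq[of x "y - y'"] norm_mult_ineq[of "y - y'" x]
    by (simp_all add: left_diff_distrib right_diff_distrib mult.commute)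
  have "\<exists>!y. 1 + x * y = y"
    using assms lip by (intro banach_fix_type[of "norm x"]) (auto simp: dist_norm)
  then obtain y where y: "1 + x * y = y" by auto
  have "\<exists>!z. 1 + z * x = z"
    using assms lip by (intro banach_fix_type[of "norm x"]) (auto simp: dist_norm)
  then obtain z where z: "1 + z * x = z" by auto
  have 1: "(1 - x) * y = 1" using y by (simp add: left_diff_distrib diff_eq_eq)
  have 2: "z * (1 - x) = 1" using z by (simp add: right_diff_distrib diff_eq_eq)
  have "z = y" using 1 2 by (metis mult.assoc mult_1_left mult_1_right)
  then show ?thesis using 1 2 by (auto simp: two_sided_inverse_def)
qed

text \<open>
  Openness of the set of invertible elements and local Lipschitz continuity of inversion in one
  estimate: \<open>b = a * (1 - u * (a - b))\<close>, and the second factor is inverted by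
  \<open>neumann_inverse\<close>.
\<close>

lemma inverse_perturbation:
  fixes a b u :: "'a::unital_cstar_algebra"
  assumes u: "two_sided_inverse a u" and small: "norm u * norm (a - b) \<le> 1/2"
  shows "\<exists>v. two_sided_inverse b v \<and> norm (v - u) \<le> 2 * (norm u)\<^sup>2 * norm (a - b)"
proof -
  define x where "x = u * (a - b)"
  have nx: "norm x \<le> norm u * norm (a - b)" by (simp add: x_def norm_mult_ineq)
  then obtain y where y: "two_sided_inverse (1 - x) y"
    using neumann_inverse[of x] small by force
  have b: "b = a * (1 - x)"
    using u by (simp add: x_def two_sided_inverse_def right_diff_distrib flip: mult.assoc)
  have inv: "two_sided_inverse b (y * u)"
    unfolding b by (rule two_sided_inverse_mult[OF u y])
  have y1: "y - 1 = x * y"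
    using y by (simp add: two_sided_inverse_def left_diff_distrib algebra_simps)
  have "norm y \<le> norm (1::'a) + norm (x * y)"
    using norm_triangle_ineq[of 1 "y - 1"] unfolding y1[symmetric] by simp
  also have "\<dots> \<le> 1 + 1/2 * norm y"
    using norm_one_le_one[where 'a='a] norm_mult_ineq[of x y]
      mult_right_mono[of "norm x" "1/2" "norm y"] nx small by simp
  finally have ny: "norm y \<le> 2" by simp
  have "norm (y * u - u) = norm (x * y * u)"
    using y1 by (simp add: left_diff_distrib flip: y1)
  also have "\<dots> \<le> (norm x * norm y) * norm u"
    by (meson norm_mult_ineq mult_right_mono norm_ge_zero order_trans)
  also have "\<dots> \<le> ((norm u * norm (a - b)) * 2) * norm u"
    using nx ny by (intro mult_right_mono mult_mono) auto
  finally show ?thesis using inv by (auto simp: power2_eq_square algebra_simps)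
qed

lemma cmod_spectrum_le_norm:
  fixes a :: "'a::unital_cstar_algebra"
  assumes "c \<in> spectrum a" shows "cmod c \<le> norm a"
proof (rule ccontr)
  assume "\<not> ?thesis"
  then have lt: "norm a < cmod c" and c: "c \<noteq> 0" by auto
  have "norm (inverse c *\<^sub>C a) < 1"
    using lt c by (simp add: norm_scaleC norm_inverse inverse_eq_divide[of "cmod c"])
  then obtain y where "two_sided_inverse (1 - inverse c *\<^sub>C a) y" using neumann_inverse by blast
  then have "two_sided_inverse ((- c) *\<^sub>C (1 - inverse c *\<^sub>C a)) (inverse (- c) *\<^sub>C y)"
    using two_sided_inverse_scaleC c by (metis neg_equal_0_iff_equal)
  moreover have "(- c) *\<^sub>C (1 - inverse c *\<^sub>C a) = a - c *\<^sub>C 1"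
    using c by (simp add: scaleC_minus_left scaleC_diff_right scaleC_scaleC)
  ultimately show False using assms spectrum_iff by metis
qed

section \<open>The norm of a self-adjoint element is attained on its spectrum\<close>

text \<open>
  The partial fraction identity \<open>1 / (1 - x\<^sup>2) = (1 / (1 - x) + 1 / (1 + x)) / 2\<close>.  Iterated, it
  writes the inverse of \<open>1 - x ^ 2 ^ m\<close> as an average of the inverses of \<open>1 - \<omega> x\<close> over the roots
  of unity \<open>\<omega>\<close> of order \<open>2 ^ m\<close>.
\<close>

lemma inverse_one_minus_square:
  fixes x p q :: "'a::unital_cstar_algebra"
  assumes "two_sided_inverse (1 - x) p" "two_sided_inverse (1 + x) q"
  shows "two_sided_inverse (1 - x * x) ((1/2) *\<^sub>R (p + q))"
proof -
  have e: "1 - x * x = (1 + x) * (1 - x)" "1 - x * x = (1 - x) * (1 + x)"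
    by (simp_all add: algebra_simps)
  have "(1 - x * x) * p = 1 + x" "(1 - x * x) * q = 1 - x"
    using assms by (simp add: e(1) mult.assoc two_sided_inverse_def,
        simp add: e(2) mult.assoc two_sided_inverse_def)
  moreover have "p * (1 - x * x) = 1 + x" "q * (1 - x * x) = 1 - x"
    using assms by (simp add: e(2) two_sided_inverse_def flip: mult.assoc,
        simp add: e(1) two_sided_inverse_def flip: mult.assoc)
  ultimately show ?thesis
    by (simp add: two_sided_inverse_def distrib_left distrib_right scaleR_2[symmetric])
qed

lemma selfadjoint_power2:
  fixes a :: "'a::unital_cstar_algebra"
  assumes "star a = a"
  shows "star (a ^ 2 ^ m) = a ^ 2 ^ m \<and> norm (a ^ 2 ^ m) = norm a ^ 2 ^ m"
proof (induction m)
  case 0 then show ?case using assms by simp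
next
  case (Suc m)
  then show ?case
    using norm_selfadjoint_square[of "a ^ 2 ^ m"]
    by (simp add: mult_2 power_add star_mult power2_eq_square)
qed

text \<open>
  Compactness of the unit circle: otherwise some points \<open>\<mu> n\<close> whose inverses have norms
  tending to infinity would accumulate at a point \<open>l\<close>, near which \<open>inverse_perturbation\<close>
  bounds the inverses.
\<close>

lemma bounded_inverses_on_circle:
  fixes a :: "'a::unital_cstar_algebra"
  assumes ex: "\<And>\<mu>. cmod \<mu> = 1 \<Longrightarrow> \<exists>u. two_sided_inverse (1 - \<mu> *\<^sub>C a) u"
  shows "\<exists>K\<ge>1. \<forall>\<mu>. cmod \<mu> = 1 \<longrightarrow> (\<exists>u. two_sided_inverse (1 - \<mu> *\<^sub>C a) u \<and> norm u \<le> K)"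
proof (rule ccontr)
  assume neg: "\<not> ?thesis"
  have "\<exists>\<mu>. cmod \<mu> = 1 \<and> (\<forall>u. two_sided_inverse (1 - \<mu> *\<^sub>C a) u \<longrightarrow> norm u > real n + 1)" for n
    using neg by (auto simp: not_le dest!: spec[of _ "real n + 1"])
  then obtain \<mu> where \<mu>: "\<And>n. cmod (\<mu> n) = 1"
    and big: "\<And>n u. two_sided_inverse (1 - \<mu> n *\<^sub>C a) u \<Longrightarrow> norm u > real n + 1"
    by metis
  obtain l r where l: "cmod l = 1" and r: "strict_mono r" and lim: "(\<mu> \<circ> r) \<longlonglongrightarrow> l"
  proof -
    have "\<forall>n. \<mu> n \<in> sphere 0 1" using \<mu> by simp
    then show ?thesis
      using compact_sphere[of "0::complex" 1] that unfolding compact_def by fastforce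
  qed
  obtain u where u: "two_sided_inverse (1 - l *\<^sub>C a) u" using ex[OF l] by blast
  have "(\<lambda>n. norm u * (cmod (\<mu> (r n) - l) * norm a)) \<longlonglongrightarrow> norm u * (cmod (l - l) * norm a)"
    using lim by (intro tendsto_intros) (simp add: o_def)
  then have "\<forall>\<^sub>F n in sequentially. norm u * (cmod (\<mu> (r n) - l) * norm a) < 1/2"
    by (intro order_tendstoD) auto
  moreover have "\<forall>\<^sub>F n in sequentially. 2 * norm u \<le> real n"
    by real_asymp
  ultimately have "\<forall>\<^sub>F n in sequentially. norm u * (cmod (\<mu> (r n) - l) * norm a) < 1/2 \<and>
      2 * norm u \<le> real n" by (rule eventually_conj)
  then obtain n where n: "norm u * (cmod (\<mu> (r n) - l) * norm a) < 1/2" "2 * norm u \<le> real n"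
    by (auto simp: eventually_sequentially)
  have diff: "norm ((1 - l *\<^sub>C a) - (1 - \<mu> (r n) *\<^sub>C a)) = cmod (\<mu> (r n) - l) * norm a"
    by (simp flip: scaleC_diff_left norm_scaleC)
  obtain v where v: "two_sided_inverse (1 - \<mu> (r n) *\<^sub>C a) v"
    and vu: "norm (v - u) \<le> 2 * (norm u)\<^sup>2 * norm ((1 - l *\<^sub>C a) - (1 - \<mu> (r n) *\<^sub>C a))"
    using inverse_perturbation[OF u, of "1 - \<mu> (r n) *\<^sub>C a"] n diff by auto
  have "norm (v - u) \<le> 2 * norm u * (norm u * (cmod (\<mu> (r n) - l) * norm a))"
    using vu diff by (simp add: power2_eq_square algebra_simps)
  also have "\<dots> \<le> 2 * norm u * (1/2)" using n by (intro mult_left_mono) auto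
  finally have "norm v \<le> 2 * norm u" using norm_triangle_ineq2[of v u] by simp
  moreover have "norm v > real (r n) + 1" using big[OF v] .
  ultimately show False using n seq_suble[OF r, of n] by linarith
qed

text \<open>
  Suppose that \<open>1 - \<mu> a\<close> is invertible on the whole unit circle.  By uniform continuity of
  inversion there, the inverses at \<open>\<mu>\<close> and at \<open>r \<mu>\<close> are close for some \<open>r < 1\<close>, uniformly
  in \<open>\<mu>\<close>.  Averaging over roots of unity preserves closeness, so the inverses of
  \<open>1 - a ^ N\<close> and \<open>1 - r ^ N a ^ N\<close> are equally close for every \<open>N = 2 ^ m\<close>.  For large \<open>N\<close>
  the second is close to \<open>1\<close>, hence so is the first, which forces \<open>norm (a ^ N) < 1\<close>.  But
  \<open>norm (a ^ N) = 1\<close> by the \<open>C\<^sup>*\<close>-identity.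
\<close>

lemma unit_selfadjoint_singular_on_circle:
  fixes a :: "'a::unital_cstar_algebra"
  assumes sa: "star a = a" and na: "norm a = 1"
  shows "\<exists>\<mu>. cmod \<mu> = 1 \<and> (\<nexists>u. two_sided_inverse (1 - \<mu> *\<^sub>C a) u)"
proof (rule ccontr)
  assume "\<not> ?thesis"
  then obtain K where K: "K \<ge> 1"
    and bd: "\<And>\<mu>. cmod \<mu> = 1 \<Longrightarrow> \<exists>u. two_sided_inverse (1 - \<mu> *\<^sub>C a) u \<and> norm u \<le> K"
    using bounded_inverses_on_circle[of a] by blast
  \<comment> \<open>With this \<open>\<delta>\<close>, the bound of \<open>inverse_perturbation\<close> is
     \<open>2 * K\<^sup>2 * \<delta> = 1/8\<close>, and the total error \<open>1/8 + 1/8\<close> below is small enough for a contradiction.\<close>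
  define \<delta> where "\<delta> = 1 / (16 * K\<^sup>2)"
  define r where "r = 1 - \<delta>"
  have K2: "K\<^sup>2 \<ge> K" "K\<^sup>2 \<ge> 1" using K by (auto simp: power2_eq_square mult_ge1_I)
  have \<delta>: "0 < \<delta>" "\<delta> \<le> 1/16" "K * \<delta> \<le> 1/2" "2 * K\<^sup>2 * \<delta> = 1/8"
    using K K2 by (auto simp: \<delta>_def field_simps)
  have r: "0 < r" "r < 1" using \<delta> by (auto simp: r_def)
  \<comment> \<open>Quantifying over all \<open>\<mu>\<close> lets the step apply the hypothesis to the two square roots
     of \<open>\<mu>\<close>, so that no sum over roots of unity has to be written down.\<close>
  have doubling: "\<forall>\<mu>. cmod \<mu> = 1 \<longrightarrow> (\<exists>u v. two_sided_inverse (1 - \<mu> *\<^sub>C a ^ 2 ^ m) u \<and>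
      two_sided_inverse (1 - (of_real (r ^ 2 ^ m) * \<mu>) *\<^sub>C a ^ 2 ^ m) v \<and> norm (u - v) \<le> 1/8)" for m
  proof (induction m)
    case 0
    show ?case
    proof (intro allI impI)
      fix \<mu> :: complex assume \<mu>: "cmod \<mu> = 1"
      obtain u where u: "two_sided_inverse (1 - \<mu> *\<^sub>C a) u" and uK: "norm u \<le> K"
        using bd[OF \<mu>] by blast
      let ?b = "1 - (r * \<mu>) *\<^sub>C a"
      have "(1 - \<mu> *\<^sub>C a) - ?b = (- of_real \<delta> * \<mu>) *\<^sub>C a"
        by (simp add: r_def left_diff_distrib scaleC_diff_left scaleC_minus_left)
      then have diff: "norm ((1 - \<mu> *\<^sub>C a) - ?b) = \<delta>"
        using \<mu> na \<delta> by (simp add: norm_scaleC norm_mult)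
      have "norm u * \<delta> \<le> K * \<delta>" using uK \<delta> by (intro mult_right_mono) auto
      then have le: "norm u * norm ((1 - \<mu> *\<^sub>C a) - ?b) \<le> 1/2" using \<delta>(3) unfolding diff by linarith
      obtain v where v: "two_sided_inverse ?b v" "norm (v - u) \<le> 2 * (norm u)\<^sup>2 * \<delta>"
        using inverse_perturbation[OF u le] unfolding diff by blast
      have "2 * (norm u)\<^sup>2 * \<delta> \<le> 2 * K\<^sup>2 * \<delta>"
        using uK \<delta> by (intro mult_right_mono mult_left_mono power_mono) auto
      then have "norm (u - v) \<le> 1/8" using v \<delta> by (simp add: norm_minus_commute)
      then show "\<exists>u v. two_sided_inverse (1 - \<mu> *\<^sub>C a ^ 2 ^ 0) u \<and>
        two_sided_inverse (1 - (of_real (r ^ 2 ^ 0) * \<mu>) *\<^sub>C a ^ 2 ^ 0) v \<and> norm (u - v) \<le> 1/8"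
        using u v by auto
    qed
  next
    case (Suc m)
    show ?case
    proof (intro allI impI)
      fix \<mu> :: complex assume \<mu>: "cmod \<mu> = 1"
      define \<nu> where "\<nu> = csqrt \<mu>"
      have \<nu>2: "\<nu> * \<nu> = \<mu>" by (simp add: \<nu>_def flip: power2_eq_square)
      have \<nu>: "cmod \<nu> = 1" using \<mu> by (simp add: \<nu>_def)
      let ?A = "a ^ 2 ^ m" and ?R = "complex_of_real (r ^ 2 ^ m)"
      obtain u v where uv: "two_sided_inverse (1 - \<nu> *\<^sub>C ?A) u"
        "two_sided_inverse (1 - (?R * \<nu>) *\<^sub>C ?A) v" "norm (u - v) \<le> 1/8"
        using Suc.IH[rule_format, OF \<nu>] by blast
      obtain u' v' where uv': "two_sided_inverse (1 - (- \<nu>) *\<^sub>C ?A) u'"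
        "two_sided_inverse (1 - (?R * (- \<nu>)) *\<^sub>C ?A) v'" "norm (u' - v') \<le> 1/8"
        using Suc.IH[rule_format, of "- \<nu>"] \<nu> by auto
      have "two_sided_inverse (1 - (\<nu> *\<^sub>C ?A) * (\<nu> *\<^sub>C ?A)) ((1/2) *\<^sub>R (u + u'))"
        using uv(1) uv'(1) by (intro inverse_one_minus_square) (simp_all add: scaleC_minus_left)
      moreover have "two_sided_inverse (1 - ((?R * \<nu>) *\<^sub>C ?A) * ((?R * \<nu>) *\<^sub>C ?A))
          ((1/2) *\<^sub>R (v + v'))"
        using uv(2) uv'(2) by (intro inverse_one_minus_square) (simp_all add: scaleC_minus_left)
      moreover have "(\<nu> *\<^sub>C ?A) * (\<nu> *\<^sub>C ?A) = \<mu> *\<^sub>C a ^ 2 ^ Suc m"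
        by (simp add: mult_scaleC_left mult_scaleC_right scaleC_scaleC \<nu>2 mult_2 power_add)
      moreover have "((?R * \<nu>) *\<^sub>C ?A) * ((?R * \<nu>) *\<^sub>C ?A) = (of_real (r ^ 2 ^ Suc m) * \<mu>) *\<^sub>C a ^ 2 ^ Suc m"
        by (simp add: mult_scaleC_left mult_scaleC_right scaleC_scaleC mult_2 power_add
            flip: \<nu>2) (simp add: mult_ac)
      moreover have "norm ((1/2) *\<^sub>R (u + u') - (1/2) *\<^sub>R (v + v')) \<le> 1/8"
      proof -
        have "(1/2) *\<^sub>R (u + u') - (1/2) *\<^sub>R (v + v') = (1/2) *\<^sub>R ((u - v) + (u' - v'))"
          by (simp add: algebra_simps)
        then show ?thesis using norm_triangle_ineq[of "u - v" "u' - v'"] uv uv' by simp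
      qed
      ultimately show "\<exists>u v. two_sided_inverse (1 - \<mu> *\<^sub>C a ^ 2 ^ Suc m) u \<and>
        two_sided_inverse (1 - (of_real (r ^ 2 ^ Suc m) * \<mu>) *\<^sub>C a ^ 2 ^ Suc m) v \<and> norm (u - v) \<le> 1/8"
        by metis
    qed
  qed
  have "(\<lambda>n. r ^ n) \<longlonglongrightarrow> 0" using r by (intro LIMSEQ_power_zero) auto
  then obtain n where "r ^ n < 1/16"
    by (metis (no_types, lifting) order_tendstoD(2) eventually_sequentially order_refl
        zero_less_divide_1_iff zero_less_numeral)
  moreover have "r ^ 2 ^ n \<le> r ^ n" using r by (intro power_decreasing) auto
  ultimately have small: "r ^ 2 ^ n < 1/16" by simp
  let ?A = "a ^ 2 ^ n" and ?x = "complex_of_real (r ^ 2 ^ n) *\<^sub>C a ^ 2 ^ n"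
  have nA: "norm ?A = 1" using selfadjoint_power2[OF sa, of n] na by simp
  obtain u v where u: "two_sided_inverse (1 - ?A) u" and v: "two_sided_inverse (1 - ?x) v"
    and uv: "norm (u - v) \<le> 1/8"
    using doubling[of n, rule_format, of 1] by auto
  have nx: "norm ?x = r ^ 2 ^ n" using nA r by (simp add: norm_scaleC norm_power)
  have n1: "norm (1::'a) \<le> 1" by (rule norm_one_le_one)
  have "two_sided_inverse (1::'a) 1" by (simp add: two_sided_inverse_def)
  moreover have "norm (1::'a) * norm (1 - (1 - ?x)) \<le> 1/2"
    using mult_mono[OF n1, of "norm ?x" "1/2"] nx small by simp
  ultimately obtain v' where v': "two_sided_inverse (1 - ?x) v'"
    and "norm (v' - 1) \<le> 2 * (norm (1::'a))\<^sup>2 * norm (1 - (1 - ?x))"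
    using inverse_perturbation by blast
  moreover have "2 * (norm (1::'a))\<^sup>2 * norm (1 - (1 - ?x)) \<le> 2 * 1 * (1/16)"
    using n1 nx small r by (intro mult_mono) (auto simp: power_le_one)
  ultimately have "norm (v - 1) \<le> 1/8"
    using two_sided_inverse_unique[OF v v'] by simp
  then have u1: "norm (u - 1) \<le> 1/4"
    using uv norm_triangle_ineq[of "u - v" "v - 1"] by simp
  \<comment> \<open>Since \<open>u\<close> inverts \<open>1 - ?A\<close>, closeness of \<open>u\<close> to \<open>1\<close> makes \<open>?A\<close> small.\<close>
  have "?A = (u - 1) * (1 - ?A)"
    using u unfolding two_sided_inverse_def by (simp only: left_diff_distrib) simp
  then have "norm ?A \<le> norm (u - 1) * norm (1 - ?A)" by (metis norm_mult_ineq)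
  also have "\<dots> \<le> 1/4 * 2"
    using u1 norm_triangle_ineq4[of 1 ?A] norm_one_le_one[where 'a='a] nA
    by (intro mult_mono) auto
  finally show False using nA by simp
qed

text \<open>Rescaling to norm \<open>1\<close>: if \<open>1 - \<mu> (a / t)\<close> is singular, then \<open>t / \<mu>\<close> lies in the spectrum.\<close>

lemma norm_attained_on_spectrum:
  fixes a :: "'a::unital_cstar_algebra"
  assumes sa: "star a = a" and "a \<noteq> 0"
  shows "\<exists>c\<in>spectrum a. cmod c = norm a"
proof -
  define t where "t = norm a"
  have t: "t > 0" using assms by (simp add: t_def)
  define b where "b = (1 / t) *\<^sub>R a"
  have "star b = b" "norm b = 1" using sa t by (auto simp: b_def star_scaleR t_def)
  then obtain \<mu> where \<mu>: "cmod \<mu> = 1" and sing: "\<nexists>u. two_sided_inverse (1 - \<mu> *\<^sub>C b) u"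
    using unit_selfadjoint_singular_on_circle by blast
  define c where "c = t / \<mu>"
  have \<mu>0: "\<mu> \<noteq> 0" using \<mu> by auto
  have c: "cmod c = t" using \<mu> t by (simp add: c_def norm_divide)
  have "c \<in> spectrum a"
  proof (rule ccontr)
    assume "c \<notin> spectrum a"
    then obtain u where "two_sided_inverse (a - c *\<^sub>C 1) u" by (auto simp: spectrum_iff)
    then have "two_sided_inverse ((- \<mu> / t) *\<^sub>C (a - c *\<^sub>C 1)) (inverse (- \<mu> / t) *\<^sub>C u)"
      using \<mu>0 t by (intro two_sided_inverse_scaleC) auto
    moreover have "(- \<mu> / t) *\<^sub>C (a - c *\<^sub>C 1) = 1 - \<mu> *\<^sub>C b"
      using \<mu>0 t by (simp add: b_def c_def scaleC_diff_right scaleC_scaleC scaleR_scaleC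
          scaleC_minus_left)
    ultimately show False using sing by metis
  qed
  then show ?thesis using c t_def by blast
qed

section \<open>Positive elements\<close>

lemma spectrum_real_minus:
  fixes a :: "'a::unital_cstar_algebra"
  shows "c \<in> spectrum (t *\<^sub>R 1 - a) \<longleftrightarrow> of_real t - c \<in> spectrum a"
proof -
  have e: "t *\<^sub>R 1 - a - c *\<^sub>C 1 = - (a - (of_real t - c) *\<^sub>C 1)"
    by (simp add: scaleR_scaleC scaleC_diff_left)
  have "two_sided_inverse (- x) y \<longleftrightarrow> two_sided_inverse x (- y)" for x y :: 'a
    by (simp add: two_sided_inverse_def)
  then show ?thesis unfolding spectrum_iff e by (metis minus_minus)
qed

text \<open>
  Shifting \<open>a\<close> by \<open>i t\<close> shifts \<open>c\<close> by \<open>i t\<close>, while the \<open>C\<^sup>*\<close>-identity bounds the squared norm of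
  the shifted element by \<open>(norm a)\<^sup>2 + t\<^sup>2\<close>.  For \<open>Im c \<noteq> 0\<close> the term \<open>2 * Im c * t\<close> on the other
  side is unbounded in \<open>t\<close>.
\<close>

lemma selfadjoint_spectrum_real:
  fixes a :: "'a::unital_cstar_algebra"
  assumes sa: "star a = a" and c: "c \<in> spectrum a"
  shows "Im c = 0"
proof (rule ccontr)
  assume im: "Im c \<noteq> 0"
  have bound: "(Re c)\<^sup>2 + (Im c + t)\<^sup>2 \<le> (norm a)\<^sup>2 + t\<^sup>2" for t
  proof -
    let ?i = "\<i> * complex_of_real t"
    let ?b = "a + ?i *\<^sub>C 1"
    have "?b - (c + ?i) *\<^sub>C 1 = a - c *\<^sub>C 1" by (simp add: scaleC_add_left)
    then have "c + ?i \<in> spectrum ?b" using c unfolding spectrum_iff by metis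
    then have "(cmod (c + ?i))\<^sup>2 \<le> (norm ?b)\<^sup>2" by (intro power_mono cmod_spectrum_le_norm) auto
    also have "\<dots> = norm (star ?b * ?b)" by (simp add: cstar_identity)
    also have "star ?b * ?b = a * a + (t\<^sup>2) *\<^sub>R 1"
    proof -
      let ?j = "?i *\<^sub>C (1::'a)"
      have "star ?b = a - ?j" using sa by (simp add: star_add star_scaleC scaleC_minus_left)
      moreover have "a * ?j = ?j * a" by (simp add: mult_scaleC_left mult_scaleC_right)
      moreover have "?j * ?j = - ((t\<^sup>2) *\<^sub>R 1)"
      proof -
        have "?i * ?i = - complex_of_real (t\<^sup>2)" by (simp add: power2_eq_square algebra_simps)
        then show ?thesis
          by (simp only: mult_scaleC_left mult_1_left scaleC_scaleC scaleC_minus_left scaleR_scaleC)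
      qed
      ultimately show ?thesis by (simp only: distrib_left left_diff_distrib) simp
    qed
    also have "norm \<dots> \<le> norm a * norm a + t\<^sup>2 * 1"
      by (intro norm_triangle_mono norm_mult_ineq)
        (simp only: norm_scaleR abs_power2 mult_left_mono norm_one_le_one zero_le_power2)
    finally show ?thesis by (simp add: cmod_power2 power2_eq_square[of "norm a"])
  qed
  have "2 * Im c * t \<le> (norm a)\<^sup>2" for t
    using bound[of t] zero_le_power2[of "Re c"] zero_le_power2[of "Im c"]
    unfolding power2_sum by linarith
  \<comment> \<open>This \<open>t\<close> turns the left-hand side into \<open>(norm a)\<^sup>2 + 1\<close>.\<close>
  from this[of "((norm a)\<^sup>2 + 1) / (2 * Im c)"] im show False by simp
qed

text \<open>
  The spectrum of \<open>a\<close> is real and lies in \<open>[-t, t]\<close>, and a point \<open>s\<close> of this interval is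
  nonnegative iff \<open>\<bar>t - s\<bar> \<le> t\<close>.  Since the norm of \<open>t - a\<close> is attained on its spectrum,
  the latter inequalities together say \<open>norm (t - a) \<le> t\<close>.
\<close>

lemma pos_elems_iff_norm_le:
  fixes a :: "'a::unital_cstar_algebra"
  assumes "norm a \<le> t"
  shows "a \<in> pos_elems \<longleftrightarrow> star a = a \<and> norm (t *\<^sub>R 1 - a) \<le> t"
proof (intro iffI conjI)
  assume a: "a \<in> pos_elems"
  then show sa: "star a = a" by (simp add: pos_elems_def)
  show "norm (t *\<^sub>R 1 - a) \<le> t"
  proof (cases "t *\<^sub>R 1 - a = 0")
    case True
    then show ?thesis using assms order_trans[OF norm_ge_zero] by simp
  next
    case False
    have "star (t *\<^sub>R 1 - a) = t *\<^sub>R 1 - a" by (simp add: star_diff star_scaleR sa)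
    then obtain c where c: "c \<in> spectrum (t *\<^sub>R 1 - a)" "cmod c = norm (t *\<^sub>R 1 - a)"
      using norm_attained_on_spectrum False by blast
    then have s: "of_real t - c \<in> spectrum a" by (simp add: spectrum_real_minus)
    then obtain s where s': "s \<ge> 0" "of_real t - c = of_real s"
      using a unfolding pos_elems_def by blast
    have "s \<le> norm a" using cmod_spectrum_le_norm[OF s] s' by simp
    moreover have "c = of_real (t - s)" using s' by (simp add: algebra_simps)
    ultimately show ?thesis using c(2) s'(1) assms by (simp only: norm_of_real)
  qed
next
  assume *: "star a = a \<and> norm (t *\<^sub>R 1 - a) \<le> t"
  have "c \<in> complex_of_real ` {0..}" if c: "c \<in> spectrum a" for c
  proof -
    have im: "Im c = 0" using selfadjoint_spectrum_real * c by blast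
    have "of_real t - c \<in> spectrum (t *\<^sub>R 1 - a)" using c by (simp add: spectrum_real_minus)
    then have "cmod (of_real t - c) \<le> t" using cmod_spectrum_le_norm * order_trans by blast
    then have "t - Re c \<le> t" using complex_Re_le_cmod[of "of_real t - c"] by simp
    then show ?thesis using im by (intro image_eqI[of _ _ "Re c"]) (auto simp: complex_eq_iff)
  qed
  then show "a \<in> pos_elems" using * by (auto simp: pos_elems_def)
qed

lemma pos_elems_selfadjoint: "a \<in> pos_elems \<Longrightarrow> star a = a"
  by (simp add: pos_elems_def)

lemma pos_elems_zero [simp]: "0 \<in> (pos_elems :: 'a::unital_cstar_algebra set)"
  using pos_elems_iff_norm_le[of "0::'a" 0] by simp

lemma pos_elems_add:
  fixes a b :: "'a::unital_cstar_algebra"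
  assumes "a \<in> pos_elems" "b \<in> pos_elems"
  shows "a + b \<in> pos_elems"
proof -
  let ?t = "norm a + norm b"
  have "norm (?t *\<^sub>R 1 - (a + b)) = norm ((norm a *\<^sub>R 1 - a) + (norm b *\<^sub>R 1 - b))"
    by (simp add: algebra_simps)
  also have "\<dots> \<le> ?t"
    using assms by (intro norm_triangle_mono) (auto simp: pos_elems_iff_norm_le[OF order_refl])
  finally show ?thesis
    using assms pos_elems_iff_norm_le[OF norm_triangle_ineq, of a b]
    by (simp add: star_add pos_elems_selfadjoint)
qed

lemma pos_elems_scaleR:
  fixes a :: "'a::unital_cstar_algebra"
  assumes "a \<in> pos_elems" "0 \<le> r"
  shows "r *\<^sub>R a \<in> pos_elems"
proof -
  have "(r * norm a) *\<^sub>R 1 - r *\<^sub>R a = r *\<^sub>R (norm a *\<^sub>R 1 - a)"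
    by (simp add: scaleR_diff_right)
  then have "norm ((r * norm a) *\<^sub>R 1 - r *\<^sub>R a) = r * norm (norm a *\<^sub>R 1 - a)"
    using assms(2) by simp
  also have "\<dots> \<le> r * norm a"
    using assms by (intro mult_left_mono) (auto simp: pos_elems_iff_norm_le[OF order_refl])
  finally show ?thesis
    using assms pos_elems_iff_norm_le[of "r *\<^sub>R a" "r * norm a"]
    by (simp add: star_scaleR pos_elems_selfadjoint)
qed

text \<open>
  A convergent sequence is eventually bounded by \<open>t = norm a + 1\<close>, so that one \<open>t\<close> serves in the
  norm criterion for all its late members, and the criterion passes to the limit.
\<close>

lemma pos_elems_limit:
  fixes f :: "nat \<Rightarrow> 'a::unital_cstar_algebra"
  assumes lim: "f \<longlonglongrightarrow> a" and pos: "\<forall>\<^sub>F n in sequentially. f n \<in> pos_elems"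
  shows "a \<in> pos_elems"
proof -
  have "(\<lambda>n. norm (f n)) \<longlonglongrightarrow> norm a" using lim by (rule tendsto_norm)
  then have bd: "\<forall>\<^sub>F n in sequentially. norm (f n) < norm a + 1" by (rule order_tendstoD) simp
  let ?t = "norm a + 1"
  have "norm (?t *\<^sub>R 1 - a) \<le> ?t"
  proof (rule tendsto_upperbound)
    show "(\<lambda>n. norm (?t *\<^sub>R 1 - f n)) \<longlonglongrightarrow> norm (?t *\<^sub>R 1 - a)"
      using lim by (intro tendsto_intros)
    show "\<forall>\<^sub>F n in sequentially. norm (?t *\<^sub>R 1 - f n) \<le> ?t"
      using bd pos
    proof eventually_elim
      case (elim n)
      then show ?case using pos_elems_iff_norm_le[of "f n" ?t] by simp
    qed
  qed simp
  moreover have "star a = a"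
  proof -
    have "(\<lambda>n. norm (star (f n) - star a)) \<longlonglongrightarrow> 0"
      using tendsto_norm_zero[OF LIM_zero[OF lim]] by (simp only: star_diff[symmetric] norm_star)
    then have "(\<lambda>n. star (f n) - star a) \<longlonglongrightarrow> 0" by (rule tendsto_norm_zero_cancel)
    then have "(\<lambda>n. star (f n)) \<longlonglongrightarrow> star a" by (simp add: LIM_zero_iff)
    moreover have "\<forall>\<^sub>F n in sequentially. star (f n) = f n"
      using pos by eventually_elim (rule pos_elems_selfadjoint)
    ultimately have "f \<longlonglongrightarrow> star a" by (rule Lim_transform_eventually)
    then show ?thesis using lim LIMSEQ_unique by blast
  qed
  ultimately show ?thesis using pos_elems_iff_norm_le[of a ?t] by simp
qed

lemma zero_cstar_le_iff: "0 \<preceq> a \<longleftrightarrow> a \<in> pos_elems"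
  by (simp add: cstar_le_def)

lemma cstar_le_refl [simp]: "a \<preceq> a"
  by (simp add: cstar_le_def)

lemma cstar_le_trans: "a \<preceq> b \<Longrightarrow> b \<preceq> c \<Longrightarrow> a \<preceq> c"
  unfolding cstar_le_def using pos_elems_add[of "b - a" "c - b"] by simp

lemma cstar_le_add: "a \<preceq> b \<Longrightarrow> a' \<preceq> b' \<Longrightarrow> a + a' \<preceq> b + b'"
  unfolding cstar_le_def using pos_elems_add[of "b - a" "b' - a'"] by (simp add: algebra_simps)

lemma cstar_le_scaleR: "a \<preceq> b \<Longrightarrow> 0 \<le> r \<Longrightarrow> r *\<^sub>R a \<preceq> r *\<^sub>R b"
  unfolding cstar_le_def using pos_elems_scaleR[of "b - a" r] by (simp add: algebra_simps)

lemma cstar_le_scaleR_right: "a \<in> pos_elems \<Longrightarrow> r \<le> s \<Longrightarrow> r *\<^sub>R a \<preceq> s *\<^sub>R a"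
  unfolding cstar_le_def using pos_elems_scaleR[of a "s - r"] by (simp add: algebra_simps)

lemma pos_elems_norm_minus:
  fixes b :: "'a::unital_cstar_algebra"
  assumes b: "b \<in> pos_elems"
  shows "norm b *\<^sub>R 1 - b \<in> pos_elems"
proof -
  have "c \<in> complex_of_real ` {0..}" if "c \<in> spectrum (norm b *\<^sub>R 1 - b)" for c
  proof -
    have s: "of_real (norm b) - c \<in> spectrum b" using that by (simp add: spectrum_real_minus)
    then obtain s where s': "s \<ge> 0" "of_real (norm b) - c = of_real s"
      using b unfolding pos_elems_def by blast
    have "s \<le> norm b" using cmod_spectrum_le_norm[OF s] s' by simp
    moreover have "c = of_real (norm b - s)" using s' by (simp add: algebra_simps)
    ultimately show ?thesis by (intro image_eqI[of _ _ "norm b - s"]) auto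
  qed
  moreover have "star (norm b *\<^sub>R 1 - b) = norm b *\<^sub>R 1 - b"
    using b by (simp add: star_diff star_scaleR pos_elems_selfadjoint)
  ultimately show ?thesis by (auto simp: pos_elems_def)
qed

text \<open>
  \<open>norm b - a = (norm b - b) + (b - a)\<close> is a sum of positive elements, so the spectrum
  of \<open>a\<close> lies below \<open>norm b\<close>; and \<open>norm a\<close> is attained there.
\<close>

lemma norm_mono_cstar_le:
  fixes a b :: "'a::unital_cstar_algebra"
  assumes a: "a \<in> pos_elems" and ab: "a \<preceq> b"
  shows "norm a \<le> norm b"
proof (cases "a = 0")
  case False
  have "b \<in> pos_elems"
    using cstar_le_trans[of 0 a b] a ab by (simp add: zero_cstar_le_iff)
  then have ta: "norm b *\<^sub>R 1 - a \<in> pos_elems"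
    using pos_elems_add[OF pos_elems_norm_minus, of b "b - a"] ab by (simp add: cstar_le_def)
  obtain c where c: "c \<in> spectrum a" "cmod c = norm a"
    using norm_attained_on_spectrum False pos_elems_selfadjoint[OF a] by blast
  then obtain s where s: "s \<ge> 0" "c = of_real s" using a unfolding pos_elems_def by blast
  have "of_real (norm b) - c \<in> spectrum (norm b *\<^sub>R 1 - a)"
    using c by (simp add: spectrum_real_minus)
  then have "of_real (norm b) - c \<in> complex_of_real ` {0..}" using ta unfolding pos_elems_def by blast
  then obtain s' where "s' \<ge> 0" "of_real (norm b) - c = of_real s'" by blast
  then have "norm b - s = s'" using s(2) by (simp flip: of_real_diff)
  then show ?thesis using c s \<open>s' \<ge> 0\<close> by simp
qed simp

section \<open>Iterates of a weak contraction\<close>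

locale weak_contraction_space = complete_cstar_metric_space X d
  for X :: "'x set" and d :: "'x \<Rightarrow> 'x \<Rightarrow> 'a::unital_cstar_algebra" +
  fixes \<phi> :: "'x \<Rightarrow> 'a" and F :: "'a \<Rightarrow> 'a \<Rightarrow> 'a \<Rightarrow> 'a" and T :: "'x \<Rightarrow> 'x"
    and k \<alpha> :: real
  assumes \<phi>_pos: "\<phi> \<in> X \<rightarrow> pos_elems"
    and F_control: "F \<in> control_funs"
    and T_self: "T \<in> X \<rightarrow> X"
    and \<phi>_lsc: "lower_semicontinuous X d \<phi>"
    and contraction: "weak_contraction X d F \<phi> k \<alpha> T"
begin

lemma k_bounds: "0 < k" "k < 1"
  using contraction by (auto simp: weak_contraction_def)

lemma d_pos: "x \<in> X \<Longrightarrow> y \<in> X \<Longrightarrow> d x y \<in> pos_elems"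
  using nonneg by (simp add: zero_cstar_le_iff)

lemma d_self [simp]: "x \<in> X \<Longrightarrow> d x x = 0"
  using zero_iff by blast

lemma \<phi>_in_pos: "x \<in> X \<Longrightarrow> \<phi> x \<in> pos_elems"
  using \<phi>_pos by auto

lemma F_pos: "a \<in> pos_elems \<Longrightarrow> b \<in> pos_elems \<Longrightarrow> c \<in> pos_elems \<Longrightarrow> F a b c \<in> pos_elems"
  and F_ge: "a \<in> pos_elems \<Longrightarrow> b \<in> pos_elems \<Longrightarrow> c \<in> pos_elems \<Longrightarrow> a \<preceq> F a b c"
    "a \<in> pos_elems \<Longrightarrow> b \<in> pos_elems \<Longrightarrow> c \<in> pos_elems \<Longrightarrow> b \<preceq> F a b c"
  and F_zero: "F 0 0 0 = 0"
  using F_control by (auto simp: control_funs_def)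

lemma contraction_le:
  "x \<in> X \<Longrightarrow> y \<in> X \<Longrightarrow> F (d (T x) (T y)) (\<phi> (T x)) (\<phi> (T y)) \<preceq>
     k *\<^sub>R F (d x y) (\<phi> x) (\<phi> y) + \<alpha> *\<^sub>R (F (d y (T x)) (\<phi> y) (\<phi> (T x)) - F 0 (\<phi> y) (\<phi> (T x)))"
  using contraction by (simp add: weak_contraction_def)

lemma F_tendsto_zero:
  fixes a b c :: "nat \<Rightarrow> 'a"
  assumes "a \<longlonglongrightarrow> 0" "b \<longlonglongrightarrow> 0" "c \<longlonglongrightarrow> 0"
    and "\<And>n. a n \<in> pos_elems" "\<And>n. b n \<in> pos_elems" "\<And>n. c n \<in> pos_elems"
  shows "(\<lambda>n. F (a n) (b n) (c n)) \<longlonglongrightarrow> 0"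
proof -
  have "continuous_on (pos_elems \<times> pos_elems \<times> pos_elems) (\<lambda>(x, y, z). F x y z)"
    using F_control by (simp add: control_funs_def)
  moreover have "(\<lambda>n. (a n, b n, c n)) \<longlonglongrightarrow> (0, 0, 0)"
    using assms by (intro tendsto_Pair)
  ultimately have "(\<lambda>n. (\<lambda>(x, y, z). F x y z) (a n, b n, c n)) \<longlonglongrightarrow> (\<lambda>(x, y, z). F x y z) (0, 0, 0)"
    by (rule continuous_on_tendsto_compose) (use assms in auto)
  then show ?thesis by (simp add: F_zero)
qed

text \<open>
  At a fixed point \<open>x\<close>, the condition for the pair \<open>x\<close>, \<open>x\<close> reads \<open>G \<preceq> k G\<close> with
  \<open>G = F 0 (\<phi> x) (\<phi> x)\<close>, which forces \<open>G = 0\<close>, and \<open>\<phi> x \<preceq> G\<close>.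
\<close>

lemma fixed_points_subset_zero_set: "fixed_points X T \<subseteq> zero_set X \<phi>"
proof
  fix x assume "x \<in> fixed_points X T"
  then have x: "x \<in> X" and Tx: "T x = x" by (auto simp: fixed_points_def)
  let ?G = "F 0 (\<phi> x) (\<phi> x)"
  have G: "?G \<in> pos_elems" using F_pos \<phi>_in_pos x by simp
  have "?G \<preceq> k *\<^sub>R ?G" using contraction_le[OF x x] Tx x by simp
  then have "norm ?G \<le> k * norm ?G" using norm_mono_cstar_le[OF G, of "k *\<^sub>R ?G"] k_bounds by simp
  then have "norm ?G = 0" using k_bounds mult_less_cancel_right1[of "norm ?G" k] by (auto simp: not_less)
  moreover have "norm (\<phi> x) \<le> norm ?G"
    using x by (intro norm_mono_cstar_le F_ge(2) \<phi>_in_pos pos_elems_zero)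
  ultimately show "x \<in> zero_set X \<phi>" using x by (simp add: zero_set_def)
qed

lemma iterate_in_X: "x \<in> X \<Longrightarrow> (T ^^ n) x \<in> X"
  using T_self by (induction n) auto

definition step_control :: "'x \<Rightarrow> 'a" where
  "step_control x = F (d x (T x)) (\<phi> x) (\<phi> (T x))"

lemma step_control_pos: "x \<in> X \<Longrightarrow> step_control x \<in> pos_elems"
  using T_self by (auto simp: step_control_def intro!: F_pos d_pos \<phi>_in_pos)

text \<open>
  For the pair \<open>x\<close>, \<open>T x\<close> both terms multiplied by \<open>\<alpha>\<close> are \<open>F 0 (\<phi> (T x)) (\<phi> (T x))\<close> and cancel.
\<close>

lemma step_control_iterate:
  assumes x: "x \<in> X"
  shows "step_control ((T ^^ n) x) \<preceq> k ^ n *\<^sub>R step_control x"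
proof (induction n)
  case (Suc n)
  let ?y = "(T ^^ n) x"
  have y: "?y \<in> X" "T ?y \<in> X" using x iterate_in_X T_self by auto
  have "step_control (T ?y) \<preceq> k *\<^sub>R step_control ?y"
    using contraction_le[OF y] y by (simp add: step_control_def)
  moreover have "k *\<^sub>R step_control ?y \<preceq> k *\<^sub>R (k ^ n *\<^sub>R step_control x)"
    using Suc k_bounds by (intro cstar_le_scaleR) auto
  ultimately have "step_control (T ?y) \<preceq> k *\<^sub>R (k ^ n *\<^sub>R step_control x)" by (rule cstar_le_trans)
  then show ?case by simp
qed simp

lemma
  assumes x: "x \<in> X"
  shows step_le: "d ((T ^^ n) x) ((T ^^ Suc n) x) \<preceq> k ^ n *\<^sub>R step_control x"
    and \<phi>_iterate_le: "\<phi> ((T ^^ n) x) \<preceq> k ^ n *\<^sub>R step_control x"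
proof -
  let ?y = "(T ^^ n) x"
  have y: "?y \<in> X" "T ?y \<in> X" using x iterate_in_X T_self by auto
  have "d ?y (T ?y) \<preceq> step_control ?y" "\<phi> ?y \<preceq> step_control ?y"
    using F_ge y d_pos \<phi>_in_pos by (auto simp: step_control_def)
  then show "d ?y ((T ^^ Suc n) x) \<preceq> k ^ n *\<^sub>R step_control x"
    "\<phi> ?y \<preceq> k ^ n *\<^sub>R step_control x"
    using cstar_le_trans[OF _ step_control_iterate[OF x, of n]] by simp_all
qed

lemma iterates_dist_le:
  assumes x: "x \<in> X" and "n \<le> m"
  shows "d ((T ^^ n) x) ((T ^^ m) x) \<preceq> (k ^ n / (1 - k)) *\<^sub>R step_control x"
proof -
  let ?C = "step_control x"
  \<comment> \<open>The closed form of \<open>k ^ n + ... + k ^ (m - 1)\<close>.\<close>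
  have "d ((T ^^ n) x) ((T ^^ m) x) \<preceq> ((k ^ n - k ^ m) / (1 - k)) *\<^sub>R ?C"
    using \<open>n \<le> m\<close>
  proof (induction m rule: dec_induct)
    case base
    then show ?case using x iterate_in_X by simp
  next
    case (step m)
    have "d ((T ^^ n) x) ((T ^^ Suc m) x) \<preceq>
        d ((T ^^ n) x) ((T ^^ m) x) + d ((T ^^ m) x) ((T ^^ Suc m) x)"
      by (rule triangle[OF iterate_in_X iterate_in_X iterate_in_X, OF x x x])
    moreover have "d ((T ^^ n) x) ((T ^^ m) x) + d ((T ^^ m) x) ((T ^^ Suc m) x) \<preceq>
        ((k ^ n - k ^ m) / (1 - k)) *\<^sub>R ?C + k ^ m *\<^sub>R ?C"
      by (rule cstar_le_add[OF step.IH step_le[OF x]])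
    moreover have "(k ^ n - k ^ m) / (1 - k) + k ^ m = (k ^ n - k ^ Suc m) / (1 - k)"
      using k_bounds by (simp add: field_simps)
    ultimately show ?case using cstar_le_trans by (simp only: scaleR_add_left[symmetric])
  qed
  moreover have "((k ^ n - k ^ m) / (1 - k)) *\<^sub>R ?C \<preceq> (k ^ n / (1 - k)) *\<^sub>R ?C"
    using k_bounds by (intro cstar_le_scaleR_right[OF step_control_pos[OF x]] divide_right_mono) auto
  ultimately show ?thesis by (rule cstar_le_trans)
qed

lemma geometric_tendsto_zero: "(\<lambda>n. k ^ n * b) \<longlonglongrightarrow> 0" for b :: real
  using k_bounds by (intro tendsto_mult_left_zero LIMSEQ_power_zero) auto

lemma \<phi>_iterates_tendsto_zero:
  assumes x: "x \<in> X"
  shows "(\<lambda>n. \<phi> ((T ^^ n) x)) \<longlonglongrightarrow> 0"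
proof (rule Lim_null_comparison[OF _ geometric_tendsto_zero])
  show "\<forall>\<^sub>F n in sequentially. norm (\<phi> ((T ^^ n) x)) \<le> k ^ n * norm (step_control x)"
    using norm_mono_cstar_le[OF \<phi>_in_pos[OF iterate_in_X[OF x]] \<phi>_iterate_le[OF x]] k_bounds
    by simp
qed

lemma Cauchy_iterates:
  assumes x: "x \<in> X"
  shows "Cauchy_seq X d (\<lambda>n. (T ^^ n) x)"
  unfolding Cauchy_seq_def
proof (intro conjI allI impI)
  show "range (\<lambda>n. (T ^^ n) x) \<subseteq> X" using iterate_in_X x by auto
next
  fix e :: real assume "e > 0"
  let ?B = "norm (step_control x) / (1 - k)"
  obtain N where N: "k ^ N * ?B < e"
    using order_tendstoD(2)[OF geometric_tendsto_zero[of ?B] \<open>e > 0\<close>]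
    by (auto simp: eventually_sequentially)
  have ord: "norm (d ((T ^^ n) x) ((T ^^ m) x)) < e" if "N \<le> n" "n \<le> m" for n m
  proof -
    have "norm (d ((T ^^ n) x) ((T ^^ m) x)) \<le> norm ((k ^ n / (1 - k)) *\<^sub>R step_control x)"
      using that x by (intro norm_mono_cstar_le iterates_dist_le d_pos iterate_in_X)
    also have "\<dots> = k ^ n * ?B" using k_bounds by simp
    also have "\<dots> \<le> k ^ N * ?B"
      using that k_bounds by (intro mult_right_mono power_decreasing) auto
    finally show ?thesis using N by simp
  qed
  show "\<exists>N. \<forall>n\<ge>N. \<forall>m\<ge>N. norm (d ((T ^^ n) x) ((T ^^ m) x)) < e"
  proof (intro exI allI impI)
    fix n m assume "N \<le> n" "N \<le> m"
    then show "norm (d ((T ^^ n) x) ((T ^^ m) x)) < e"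
      using ord[of n m] ord[of m n] commute[OF iterate_in_X iterate_in_X, OF x x, of n m]
      by (cases "n \<le> m") auto
  qed
qed

text \<open>
  \<open>R n\<close> below is the right-hand side of the contraction condition for \<open>T\<^sup>n x\<close> and \<open>z\<close>.
  Knowing \<open>\<phi> z = 0\<close> first is essential: only then do all arguments of \<open>F\<close> in it tend to \<open>0\<close>.
\<close>

lemma limit_is_zero_and_fixed:
  assumes x: "x \<in> X" and conv: "converges_to X d (\<lambda>n. (T ^^ n) x) z"
  shows "z \<in> fixed_points X T \<inter> zero_set X \<phi>"
proof -
  let ?s = "\<lambda>n. (T ^^ n) x"
  have z: "z \<in> X" "T z \<in> X" and dlim: "(\<lambda>n. d (?s n) z) \<longlonglongrightarrow> 0"
    using conv T_self by (auto simp: converges_to_def tendsto_norm_zero_iff)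
  have s: "?s n \<in> X" for n using iterate_in_X x .
  have \<phi>z: "\<phi> z = 0"
  proof -
    have "(\<lambda>n. ereal (norm (\<phi> (?s n)))) \<longlonglongrightarrow> ereal (norm (0::'a))"
      using \<phi>_iterates_tendsto_zero[OF x] by (intro tendsto_intros)
    then have "liminf (\<lambda>n. ereal (norm (\<phi> (?s n)))) = 0"
      by (simp add: lim_imp_Liminf zero_ereal_def)
    then show ?thesis using \<phi>_lsc conv by (force simp: lower_semicontinuous_def)
  qed
  define R where "R n = k *\<^sub>R F (d (?s n) z) (\<phi> (?s n)) (\<phi> z) +
    \<alpha> *\<^sub>R (F (d z (?s (Suc n))) (\<phi> z) (\<phi> (?s (Suc n))) - F 0 (\<phi> z) (\<phi> (?s (Suc n))))" for n
  have "R \<longlonglongrightarrow> k *\<^sub>R 0 + \<alpha> *\<^sub>R (0 - 0)"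
  proof -
    have \<phi>lim: "(\<lambda>n. \<phi> (?s n)) \<longlonglongrightarrow> 0" by (rule \<phi>_iterates_tendsto_zero[OF x])
    have dlim': "(\<lambda>n. d z (?s (Suc n))) \<longlonglongrightarrow> 0"
      unfolding commute[OF z(1) s] by (rule LIMSEQ_Suc[OF dlim])
    have pos: "d (?s n) z \<in> pos_elems" "d z (?s n) \<in> pos_elems" "\<phi> (?s n) \<in> pos_elems" for n
      using z s by (auto intro: d_pos \<phi>_in_pos)
    have "(\<lambda>n. F (d (?s n) z) (\<phi> (?s n)) 0) \<longlonglongrightarrow> 0"
      by (rule F_tendsto_zero[OF dlim \<phi>lim tendsto_const]) (rule pos pos_elems_zero)+
    moreover have "(\<lambda>n. F (d z (?s (Suc n))) 0 (\<phi> (?s (Suc n)))) \<longlonglongrightarrow> 0"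
      by (rule F_tendsto_zero[OF dlim' tendsto_const LIMSEQ_Suc[OF \<phi>lim]]) (rule pos pos_elems_zero)+
    moreover have "(\<lambda>n. F 0 0 (\<phi> (?s (Suc n)))) \<longlonglongrightarrow> 0"
      by (rule F_tendsto_zero[OF tendsto_const tendsto_const LIMSEQ_Suc[OF \<phi>lim]])
        (rule pos pos_elems_zero)+
    ultimately show ?thesis unfolding R_def \<phi>z by (intro tendsto_intros)
  qed
  then have R: "R \<longlonglongrightarrow> 0" by simp
  have "d (?s (Suc n)) (T z) \<preceq> R n" for n
  proof (rule cstar_le_trans)
    show "d (?s (Suc n)) (T z) \<preceq> F (d (?s (Suc n)) (T z)) (\<phi> (?s (Suc n))) (\<phi> (T z))"
      using s z by (intro F_ge d_pos \<phi>_in_pos)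
    show "F (d (?s (Suc n)) (T z)) (\<phi> (?s (Suc n))) (\<phi> (T z)) \<preceq> R n"
      using contraction_le[OF s[of n] z(1)] by (simp add: R_def)
  qed
  then have "norm (d (?s (Suc n)) (T z)) \<le> norm (R n)" for n
    using s z by (intro norm_mono_cstar_le d_pos)
  then have dT: "(\<lambda>n. d (?s (Suc n)) (T z)) \<longlonglongrightarrow> 0"
    by (intro Lim_null_comparison[OF always_eventually tendsto_norm_zero[OF R]]) (rule allI)
  have "norm (d z (T z)) \<le> norm (d (?s (Suc n)) z + d (?s (Suc n)) (T z))" for n
    using triangle[OF z s[of "Suc n"]] commute[OF z(1) s[of "Suc n"]] z
    by (intro norm_mono_cstar_le d_pos) simp_all
  moreover have "(\<lambda>n. norm (d (?s (Suc n)) z + d (?s (Suc n)) (T z))) \<longlonglongrightarrow> norm (0 + 0 :: 'a)"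
    using LIMSEQ_Suc[OF dlim] dT by (intro tendsto_intros)
  ultimately have "norm (d z (T z)) \<le> norm (0 + 0 :: 'a)"
    using LIMSEQ_le_const by blast
  then have "z = T z" using zero_iff z by simp
  then show ?thesis using \<phi>z z by (simp add: fixed_points_def zero_set_def)
qed

text \<open>
  The orbit estimate and the triangle inequality bound \<open>d (T\<^sup>n x) z\<close> by the claimed bound plus
  \<open>d (T\<^sup>m x) z\<close>; the error vanishes as \<open>m\<close> grows, and the positive cone is closed.
\<close>

lemma dist_limit_le:
  assumes x: "x \<in> X" and conv: "converges_to X d (\<lambda>n. (T ^^ n) x) z"
  shows "d ((T ^^ n) x) z \<preceq> (k ^ n / (1 - k)) *\<^sub>R step_control x"
proof -
  let ?s = "\<lambda>n. (T ^^ n) x" and ?b = "(k ^ n / (1 - k)) *\<^sub>R step_control x"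
  have z: "z \<in> X" and dlim: "(\<lambda>m. d (?s m) z) \<longlonglongrightarrow> 0"
    using conv by (auto simp: converges_to_def tendsto_norm_zero_iff)
  have s: "?s m \<in> X" for m using iterate_in_X x .
  have "(\<lambda>m. ?b + d (?s m) z - d (?s n) z) \<longlonglongrightarrow> ?b + 0 - d (?s n) z"
    using dlim by (intro tendsto_intros)
  moreover have "?b + d (?s m) z - d (?s n) z \<in> pos_elems" if "n \<le> m" for m
    using cstar_le_trans[OF triangle[OF s z s] cstar_le_add[OF iterates_dist_le[OF x that] cstar_le_refl]]
    by (simp add: cstar_le_def)
  then have "\<forall>\<^sub>F m in sequentially. ?b + d (?s m) z - d (?s n) z \<in> pos_elems"
    using eventually_sequentially by blast
  ultimately have "?b + 0 - d (?s n) z \<in> pos_elems" by (rule pos_elems_limit)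
  then show ?thesis by (simp add: cstar_le_def)
qed

lemma weakly_Picard: "weakly_Picard X d \<phi> T"
proof -
  have *: "\<exists>z. converges_to X d (\<lambda>n. (T ^^ n) x) z \<and> z \<in> fixed_points X T \<inter> zero_set X \<phi>"
    if "x \<in> X" for x
    using complete[OF Cauchy_iterates[OF that]] limit_is_zero_and_fixed[OF that] by blast
  then show ?thesis using nonempty unfolding weakly_Picard_def by blast
qed

end

theorem theorem3p13:
  fixes X :: "'x set"
    and d :: "'x \<Rightarrow> 'x \<Rightarrow> 'a::unital_cstar_algebra"
    and \<phi> :: "'x \<Rightarrow> 'a"
    and F :: "'a \<Rightarrow> 'a \<Rightarrow> 'a \<Rightarrow> 'a"
    and T :: "'x \<Rightarrow> 'x"
    and k \<alpha> :: real
  assumes "complete_cstar_metric_space X d"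
    and "\<phi> \<in> X \<rightarrow> pos_elems"
    and "F \<in> control_funs"
    and "T \<in> X \<rightarrow> X"
    and "lower_semicontinuous X d \<phi>"
    and "weak_contraction X d F \<phi> k \<alpha> T"
  shows "fixed_points X T \<subseteq> zero_set X \<phi> \<and>
    weakly_Picard X d \<phi> T \<and>
    (\<forall>x\<in>X. \<forall>z. converges_to X d (\<lambda>n. (T ^^ n) x) z \<longrightarrow>
       (\<forall>n. d ((T ^^ n) x) z \<preceq> (k ^ n / (1 - k)) *\<^sub>R F (d (T x) x) (\<phi> x) (\<phi> (T x))))"
proof -
  interpret complete_cstar_metric_space X d by fact
  interpret weak_contraction_space X d \<phi> F T k \<alpha>
    by unfold_locales fact+
  have "step_control x = F (d (T x) x) (\<phi> x) (\<phi> (T x))" if "x \<in> X" for x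
    unfolding step_control_def commute[OF that funcset_mem[OF T_self that]] ..
  then show ?thesis
    using fixed_points_subset_zero_set weakly_Picard dist_limit_le by metis
qed

end
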